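(* Let $T$ be a subcubic tree of order $n$ and independence number $\alpha$. Then $$\sharp\alpha(T)\leq \left(\frac{1+\sqrt{5}}{2}\right)^{2n-3\alpha+1}.$$
   Context: All graphs are finite, simple, and undirected. The order of a graph is its number of vertices. A graph is subcubic if its maximum degree is at most $3$. The independence number of a graph is the maximum cardinality of a set of pairwise non-adjacent vertices (an independent set). An independent set is maximum if its cardinality equals the independence number, and $\sharp\alpha(G)$ denotes the number of maximum independent sets in a graph $G$. *)

theory Defs
  imports Complex_Main "Graph_Theory.Graph_Theory"
begin

text \<open>
  Finite simple undirected graphs are represented by the locale predicate
  \<^const>\<open>pair_graph\<close>: finite, loop-free, without parallel arcs, and symmetric. An undirected
  edge \<open>uv\<close> is the pair of arcs \<open>(u,v)\<close> and \<open>(v,u)\<close>, so the degree of a vertex is its out-degree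
  (equivalently, its in-degree).
\<close>

text \<open>
  The library's notion \<^const>\<open>tree\<close> is not usable here: it forbids directed cycles, and in a
  symmetric digraph the two arcs of any edge form a directed cycle of length 2. A cycle of the
  undirected graph is a directed cycle of length at least 3.
\<close>

definition undirected_cycle :: "'a pair_pre_digraph \<Rightarrow> ('a \<times> 'a) awalk \<Rightarrow> bool" where
  "undirected_cycle G p \<longleftrightarrow> pre_digraph.cycle (with_proj G) p \<and> 3 \<le> length p"

text \<open>
  Connectedness requires a nonempty vertex set. The name is qualified because of the
  topological notion of the same name.
\<close>

definition undirected_tree :: "'a pair_pre_digraph \<Rightarrow> bool" where
  "undirected_tree G \<longleftrightarrow>
     pair_graph G \<and> Digraph_Component.connected (with_proj G) \<and> (\<nexists>p. undirected_cycle G p)"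

definition subcubic :: "'a pair_pre_digraph \<Rightarrow> bool" where
  "subcubic G \<longleftrightarrow> (\<forall>v \<in> pverts G. out_degree (with_proj G) v \<le> 3)"

definition independent_set :: "'a pair_pre_digraph \<Rightarrow> 'a set \<Rightarrow> bool" where
  "independent_set G S \<longleftrightarrow> S \<subseteq> pverts G \<and> (\<forall>u \<in> S. \<forall>v \<in> S. (u, v) \<notin> parcs G)"

definition independence_number :: "'a pair_pre_digraph \<Rightarrow> nat" where
  "independence_number G = Max (card ` {S. independent_set G S})"

definition maximum_independent_set :: "'a pair_pre_digraph \<Rightarrow> 'a set \<Rightarrow> bool" where
  "maximum_independent_set G S \<longleftrightarrow> independent_set G S \<and> card S = independence_number G"

definition num_maximum_independent_sets :: "'a pair_pre_digraph \<Rightarrow> nat" where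
  "num_maximum_independent_sets G = card {S. maximum_independent_set G S}"

end

theory Submission
  imports Defs
begin

text \<open>
  Root the tree at a leaf, so that every vertex has at most two children. For the branch \<open>V\<close>
  at a vertex \<open>c\<close> let \<open>w = 2|V| - 3\<alpha>(V)\<close>, and let \<open>\<phi>\<close> be the golden ratio. The
  numbers of maximum independent sets of \<open>V\<close> and of \<open>V - {c}\<close> determine those of the next
  larger branch. If some maximum independent set of \<open>V\<close> avoids \<open>c\<close>, write them as
  \<open>p\<phi>\<^sup>w\<close> and \<open>q\<phi>\<^sup>w\<close>; otherwise as \<open>x\<phi>\<^sup>w\<phi>\<close> and \<open>y\<phi>\<^sup>w\<phi>\<close>. Attaching two branches
  to a new root then gives \<open>(x, y) = (qq', pp')\<close>, or \<open>(p'', q'') = ((xp + yq)/\<phi>, xp/\<phi>)\<close>, or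
  \<open>p = q = xx'\<close>, according to whether none, one or both of the branches are of the second kind,
  and these maps preserve the constraints \<open>q \<le> 1\<close>, \<open>\<phi>p + q \<le> \<phi> + 1\<close> and \<open>x \<le> 1\<close>,
  \<open>\<phi>x + y \<le> \<phi> + 1\<close>. In particular \<open>p \<le> \<phi>\<close> and \<open>x \<le> 1\<close>, which is the bound. A missing
  child is the empty branch, with \<open>p = q = 1\<close>.
\<close>

section \<open>The weight invariant\<close>

definition golden :: real where
  "golden = (1 + sqrt 5) / 2"

lemma golden_square: "golden * golden = golden + 1"
  by (simp add: golden_def field_simps)

lemma golden_gt_1: "golden > 1"
  by (simp add: golden_def)

text \<open>The quadrilateral with corners (0,0), (golden,0), (1,1) and (0,1). Its slanted side is
  essential: from \<open>p \<le> golden\<close>, \<open>q \<le> 1\<close>, \<open>x \<le> 1\<close>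
  and \<open>y \<le> golden + 1\<close> alone, the combination
  \<open>(x * p + y * q) / golden\<close> could exceed \<open>golden\<close>.\<close>

definition upper_weights :: "real \<Rightarrow> real \<Rightarrow> bool" where
  "upper_weights p q \<longleftrightarrow> 0 \<le> p \<and> 0 \<le> q \<and> q \<le> 1 \<and> golden * p + q \<le> golden + 1"

definition lower_weights :: "real \<Rightarrow> real \<Rightarrow> bool" where
  "lower_weights x y \<longleftrightarrow> 0 \<le> x \<and> 0 \<le> y \<and> x \<le> 1 \<and> golden * x + y \<le> golden + 1"

lemma upper_weights_le_golden:
  assumes "upper_weights p q"
  shows "p \<le> golden"
proof -
  have "golden * p \<le> golden * golden"
    using assms by (simp add: upper_weights_def golden_square)
  then show ?thesis
    using golden_gt_1 by simp
qed

text \<open>After scaling by the square of golden, which is \<open>golden + 1\<close>, the bounds on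
  \<open>p\<close> and \<open>p'\<close> can be multiplied. The slack left over is
  \<open>(golden + 1) * (q * (1 - q') + q' * (1 - q))\<close>.\<close>

lemma lower_weights_mult:
  assumes "upper_weights p q" and "upper_weights p' q'"
  shows "lower_weights (q * q') (p * p')"
proof -
  have p: "0 \<le> p" "0 \<le> q" "q \<le> 1" "golden * p \<le> golden + 1 - q"
    and p': "0 \<le> p'" "0 \<le> q'" "q' \<le> 1" "golden * p' \<le> golden + 1 - q'"
    using assms by (auto simp: upper_weights_def)
  have "(golden * p) * (golden * p') \<le> (golden + 1 - q) * (golden + 1 - q')"
    using p p' golden_gt_1 by (intro mult_mono) auto
  then have "(golden + 1) * (p * p') \<le> (golden + 1 - q) * (golden + 1 - q')"
    by (metis (no_types, opaque_lifting) golden_square mult.assoc mult.left_commute)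
  \<comment> \<open>The factor \<open>2 * golden + 1\<close> is the cube of golden.\<close>
  moreover have "(golden + 1) * (golden * (q * q')) = (2 * golden + 1) * (q * q')"
    using golden_square by algebra
  moreover have "(golden + 1) * (golden + 1) - (golden + 1 - q) * (golden + 1 - q')
      - (2 * golden + 1) * (q * q') = (golden + 1) * (q * (1 - q') + q' * (1 - q))"
    by (simp add: algebra_simps)
  moreover have "0 \<le> (golden + 1) * (q * (1 - q') + q' * (1 - q))"
    using p p' golden_gt_1 by (intro mult_nonneg_nonneg add_nonneg_nonneg) auto
  ultimately have "(golden + 1) * (golden * (q * q') + p * p') \<le> (golden + 1) * (golden + 1)"
    unfolding distrib_left[of "golden + 1" "golden * (q * q')"] by linarith
  then have "golden * (q * q') + p * p' \<le> golden + 1"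
    using golden_gt_1 by (subst (asm) mult_le_cancel_left_pos) auto
  then show ?thesis
    using p p' by (simp add: lower_weights_def mult_le_one)
qed

text \<open>Since \<open>1 + 1 / golden = golden\<close>, the new weighted sum is
  \<open>x * (golden * p) + y * q\<close>. Inserting the bounds on \<open>golden * p\<close> and on
  \<open>y\<close> leaves \<open>(golden + 1) * (1 - (1 - x) * (1 - q))\<close>.\<close>

lemma upper_weights_combine:
  assumes "lower_weights x y" and "upper_weights p q"
  shows "upper_weights ((x * p + y * q) / golden) (x * p / golden)"
proof -
  have x: "0 \<le> x" "0 \<le> y" "x \<le> 1" "y \<le> golden + 1 - golden * x"
    and p: "0 \<le> p" "0 \<le> q" "q \<le> 1" "golden * p \<le> golden + 1 - q"
    using assms by (auto simp: upper_weights_def lower_weights_def)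
  have "golden * ((x * p + y * q) / golden) + x * p / golden = x * p * (1 + 1 / golden) + y * q"
    using golden_gt_1 by (simp add: field_simps)
  also have "1 + 1 / golden = golden"
    using golden_gt_1 golden_square by (simp add: field_simps)
  also have "x * p * golden + y * q = x * (golden * p) + y * q"
    by simp
  also have "\<dots> \<le> x * (golden + 1 - q) + (golden + 1 - golden * x) * q"
    using x p by (intro add_mono mult_left_mono mult_right_mono) auto
  also have "\<dots> = (golden + 1) * (1 - (1 - x) * (1 - q))"
    by (simp add: algebra_simps)
  also have "\<dots> \<le> (golden + 1) * 1"
    using x p golden_gt_1 by (intro mult_left_mono) auto
  finally have "golden * ((x * p + y * q) / golden) + x * p / golden \<le> golden + 1"
    by simp
  moreover have "x * p / golden \<le> 1"
  proof -
    have "x * p \<le> 1 * golden"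
      using x p upper_weights_le_golden[OF assms(2)] by (intro mult_mono) auto
    then show ?thesis
      using golden_gt_1 by simp
  qed
  ultimately show ?thesis
    using x p golden_gt_1 by (simp add: upper_weights_def)
qed

lemma upper_weights_diag:
  assumes "lower_weights x y" and "lower_weights x' y'"
  shows "upper_weights (x * x') (x * x')"
proof -
  have "0 \<le> x * x'" "x * x' \<le> 1"
    using assms by (auto simp: lower_weights_def mult_le_one)
  moreover from this have "golden * (x * x') \<le> golden"
    using golden_gt_1 mult_left_mono[of "x * x'" 1 golden] by simp
  ultimately show ?thesis
    by (simp add: upper_weights_def)
qed

section \<open>Counting maximum independent sets\<close>

text \<open>The graph is a bare relation and induced subgraphs are given by vertex sets, so deleting
  vertices is set difference.\<close>

locale adjacency =
  fixes E :: "'a rel"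
  assumes sym_E: "sym E" and irrefl_E: "irrefl E"
begin

definition indeps :: "'a set \<Rightarrow> 'a set set" where
  "indeps V = {S. S \<subseteq> V \<and> (\<forall>u\<in>S. \<forall>v\<in>S. (u, v) \<notin> E)}"

definition alpha :: "'a set \<Rightarrow> nat" where
  "alpha V = Max (card ` indeps V)"

definition max_indeps :: "'a set \<Rightarrow> 'a set set" where
  "max_indeps V = {S \<in> indeps V. card S = alpha V}"

definition count :: "'a set \<Rightarrow> nat" where
  "count V = card (max_indeps V)"

lemma adj_commute: "(x, y) \<in> E \<longleftrightarrow> (y, x) \<in> E"
  using sym_E by (meson symE)

lemma not_adj_self: "(x, x) \<notin> E"
  using irrefl_E by (simp add: irrefl_def)

lemma finite_indeps: "finite V \<Longrightarrow> finite (indeps V)"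
  by (rule finite_subset[of _ "Pow V"]) (auto simp: indeps_def)

lemma finite_max_indeps: "finite V \<Longrightarrow> finite (max_indeps V)"
  by (simp add: max_indeps_def finite_indeps)

lemma empty_in_indeps: "{} \<in> indeps V"
  by (simp add: indeps_def)

lemma card_le_alpha:
  assumes "finite V" and "S \<in> indeps V"
  shows "card S \<le> alpha V"
  using assms by (simp add: alpha_def finite_indeps)

lemma max_indepsE:
  assumes "finite V"
  obtains S where "S \<in> max_indeps V"
proof -
  have "alpha V \<in> card ` indeps V"
    unfolding alpha_def using assms empty_in_indeps by (intro Max_in) (auto simp: finite_indeps)
  then show ?thesis
    using that by (auto simp: max_indeps_def)
qed

lemma alpha_eqI:
  assumes "finite V" and "S \<in> indeps V" and "card S = k" and "\<And>S'. S' \<in> indeps V \<Longrightarrow> card S' \<le> k"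
  shows "alpha V = k"
proof (rule antisym)
  obtain S' where "S' \<in> max_indeps V"
    using max_indepsE[OF assms(1)] .
  then show "alpha V \<le> k"
    using assms(4)[of S'] by (simp add: max_indeps_def)
  show "k \<le> alpha V"
    using card_le_alpha[OF assms(1,2)] assms(3) by simp
qed

lemma alpha_mono:
  assumes "finite W" and "V \<subseteq> W"
  shows "alpha V \<le> alpha W"
proof -
  obtain S where "S \<in> max_indeps V"
    using max_indepsE[of V] assms finite_subset by blast
  then have "S \<in> indeps W" "card S = alpha V"
    using assms by (auto simp: max_indeps_def indeps_def)
  then show ?thesis
    using card_le_alpha assms by metis
qed

lemma alpha_empty: "alpha {} = 0"
  by (rule alpha_eqI[of _ "{}"]) (auto simp: indeps_def)

lemma count_empty: "count {} = 1"
proof -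
  have "max_indeps {} = {{}}"
    by (auto simp: max_indeps_def indeps_def alpha_empty)
  then show ?thesis
    by (simp add: count_def)
qed

section \<open>Disjoint unions with no edges across\<close>

context
  fixes V W :: "'a set"
  assumes fin: "finite V" "finite W"
    and disj: "V \<inter> W = {}"
    and nonadj: "\<And>x y. x \<in> V \<Longrightarrow> y \<in> W \<Longrightarrow> (x, y) \<notin> E"
begin

lemma Un_in_indeps: "A \<in> indeps V \<Longrightarrow> B \<in> indeps W \<Longrightarrow> A \<union> B \<in> indeps (V \<union> W)"
  using nonadj adj_commute unfolding indeps_def by blast

lemma card_Un_indeps: "A \<in> indeps V \<Longrightarrow> B \<in> indeps W \<Longrightarrow> card (A \<union> B) = card A + card B"
  using fin disj by (intro card_Un_disjoint) (auto simp: indeps_def intro: finite_subset)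

lemma indeps_Un_split:
  assumes "S \<in> indeps (V \<union> W)"
  shows "S \<inter> V \<in> indeps V" "S \<inter> W \<in> indeps W" "S = (S \<inter> V) \<union> (S \<inter> W)"
    "card S = card (S \<inter> V) + card (S \<inter> W)"
proof -
  show 1: "S \<inter> V \<in> indeps V" "S \<inter> W \<in> indeps W" "S = (S \<inter> V) \<union> (S \<inter> W)"
    using assms by (auto simp: indeps_def)
  show "card S = card (S \<inter> V) + card (S \<inter> W)"
    using card_Un_indeps[OF 1(1,2)] 1(3) by simp
qed

lemma alpha_Un: "alpha (V \<union> W) = alpha V + alpha W"
proof -
  obtain A B where A: "A \<in> max_indeps V" and B: "B \<in> max_indeps W"
    using max_indepsE fin by metis
  show ?thesis
  proof (rule alpha_eqI)
    show "A \<union> B \<in> indeps (V \<union> W)" "card (A \<union> B) = alpha V + alpha W"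
      using A B Un_in_indeps card_Un_indeps by (auto simp: max_indeps_def)
    show "card S \<le> alpha V + alpha W" if "S \<in> indeps (V \<union> W)" for S
      using indeps_Un_split[OF that] card_le_alpha fin by (metis add_mono)
  qed (use fin in simp)
qed

text \<open>Maximum independent sets of the union correspond to pairs of maximum ones: neither trace
  can exceed its own \<open>alpha\<close>, and the two sizes add up to the sum of both.\<close>

lemma count_Un: "count (V \<union> W) = count V * count W"
proof -
  have "bij_betw (\<lambda>(A, B). A \<union> B) (max_indeps V \<times> max_indeps W) (max_indeps (V \<union> W))"
  proof (rule bij_betw_byWitness[where f' = "\<lambda>S. (S \<inter> V, S \<inter> W)"])
    show "\<forall>a\<in>max_indeps V \<times> max_indeps W. (\<lambda>S. (S \<inter> V, S \<inter> W)) ((\<lambda>(A, B). A \<union> B) a) = a"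
      using disj by (fastforce simp: max_indeps_def indeps_def)
    show "\<forall>S\<in>max_indeps (V \<union> W). (\<lambda>(A, B). A \<union> B) (S \<inter> V, S \<inter> W) = S"
      by (auto simp: max_indeps_def indeps_def)
    show "(\<lambda>(A, B). A \<union> B) ` (max_indeps V \<times> max_indeps W) \<subseteq> max_indeps (V \<union> W)"
      by (auto simp: max_indeps_def Un_in_indeps card_Un_indeps alpha_Un)
    show "(\<lambda>S. (S \<inter> V, S \<inter> W)) ` max_indeps (V \<union> W) \<subseteq> max_indeps V \<times> max_indeps W"
    proof clarify
      fix S assume S: "S \<in> max_indeps (V \<union> W)"
      then have i: "S \<in> indeps (V \<union> W)" and "card S = alpha V + alpha W"
        by (auto simp: max_indeps_def alpha_Un)
      note s = indeps_Un_split[OF i]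
      have "card (S \<inter> V) \<le> alpha V" "card (S \<inter> W) \<le> alpha W"
        using s card_le_alpha fin by auto
      with s \<open>card S = alpha V + alpha W\<close> have "card (S \<inter> V) = alpha V" "card (S \<inter> W) = alpha W"
        by linarith+
      with s show "S \<inter> V \<in> max_indeps V \<and> S \<inter> W \<in> max_indeps W"
        by (simp add: max_indeps_def)
    qed
  qed
  then show ?thesis
    unfolding count_def by (metis bij_betw_same_card card_cartesian_product)
qed

end

section \<open>Splitting by membership of one vertex\<close>

context
  fixes V :: "'a set" and r :: 'a
  assumes fin: "finite V" and r: "r \<in> V"
begin

lemma insert_in_indeps:
  assumes "S \<in> indeps (V - insert r (E `` {r}))"
  shows "insert r S \<in> indeps V" "card (insert r S) = card S + 1"
proof -
  show "insert r S \<in> indeps V"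
    using assms r not_adj_self adj_commute unfolding indeps_def by blast
  have "finite S" "r \<notin> S"
    using assms fin by (auto simp: indeps_def intro: finite_subset)
  then show "card (insert r S) = card S + 1"
    by simp
qed

lemma indeps_cases:
  assumes "S \<in> indeps V"
  obtains "S \<in> indeps (V - {r})"
  | S' where "S' \<in> indeps (V - insert r (E `` {r}))" "S = insert r S'"
proof (cases "r \<in> S")
  case True
  then have "S - {r} \<in> indeps (V - insert r (E `` {r}))"
    using assms by (auto simp: indeps_def)
  with True that(2)[of "S - {r}"] show ?thesis
    by (simp add: insert_absorb)
next
  case False
  with assms that(1) show ?thesis
    by (auto simp: indeps_def)
qed

lemma alpha_delete:
  "alpha V = max (alpha (V - {r})) (alpha (V - insert r (E `` {r})) + 1)"
proof -
  let ?D = "V - {r}" and ?N = "V - insert r (E `` {r})"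
  have fin': "finite ?D" "finite ?N"
    using fin by auto
  have "alpha ?D \<le> alpha V"
    using fin by (intro alpha_mono) auto
  moreover have "alpha ?N + 1 \<le> alpha V"
    using max_indepsE[OF fin'(2)] insert_in_indeps card_le_alpha[OF fin]
    by (metis (mono_tags, lifting) max_indeps_def mem_Collect_eq)
  moreover have "alpha V \<le> max (alpha ?D) (alpha ?N + 1)"
  proof -
    obtain S where S: "S \<in> indeps V" "card S = alpha V"
      using max_indepsE[OF fin] by (auto simp: max_indeps_def)
    from S(1) show ?thesis
    proof (cases rule: indeps_cases)
      case 1
      then show ?thesis
        using card_le_alpha[OF fin'(1) 1] S by simp
    next
      case (2 S')
      then show ?thesis
        using card_le_alpha[OF fin'(2) 2(1)] insert_in_indeps(2)[OF 2(1)] S by simp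
    qed
  qed
  ultimately show ?thesis
    by simp
qed

text \<open>Sets without \<open>r\<close> live in \<open>V - {r}\<close>; sets with \<open>r\<close>
  arise by adding \<open>r\<close> to a set that avoids its closed neighbourhood. Each kind
  contributes only if its best size reaches \<open>alpha V\<close>.\<close>

lemma count_delete:
  "count V = (if alpha (V - {r}) = alpha V then count (V - {r}) else 0)
    + (if alpha (V - insert r (E `` {r})) + 1 = alpha V
       then count (V - insert r (E `` {r})) else 0)"
proof -
  let ?D = "V - {r}" and ?N = "V - insert r (E `` {r})"
  let ?A = "if alpha ?D = alpha V then max_indeps ?D else {}"
  let ?B = "if alpha ?N + 1 = alpha V then insert r ` max_indeps ?N else {}"
  have fin': "finite ?D" "finite ?N"
    using fin by auto
  have "max_indeps V = ?A \<union> ?B"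
  proof (intro equalityI subsetI)
    fix S assume S: "S \<in> max_indeps V"
    then have "S \<in> indeps V"
      by (simp add: max_indeps_def)
    then show "S \<in> ?A \<union> ?B"
    proof (cases rule: indeps_cases)
      case 1
      then have "alpha ?D = alpha V"
        using card_le_alpha[OF fin'(1) 1] alpha_mono[of V ?D] S fin by (auto simp: max_indeps_def)
      then show ?thesis
        using 1 S by (auto simp: max_indeps_def)
    next
      case (2 S')
      then have "card S' + 1 = alpha V"
        using insert_in_indeps(2) S by (simp add: max_indeps_def)
      moreover have "card S' \<le> alpha ?N"
        using card_le_alpha[OF fin'(2) 2(1)] .
      moreover have "alpha ?N + 1 \<le> alpha V"
        using alpha_delete by simp
      ultimately have "alpha ?N + 1 = alpha V" "card S' = alpha ?N"
        by linarith+
      then show ?thesis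
        using 2 by (auto simp: max_indeps_def)
    qed
  next
    fix S assume "S \<in> ?A \<union> ?B"
    then consider "alpha ?D = alpha V" "S \<in> max_indeps ?D"
      | S' where "alpha ?N + 1 = alpha V" "S' \<in> max_indeps ?N" "S = insert r S'"
      by (auto split: if_splits)
    then show "S \<in> max_indeps V"
    proof cases
      case 1
      then show ?thesis
        by (auto simp: max_indeps_def indeps_def)
    next
      case (2 S')
      then have "S' \<in> indeps ?N"
        by (simp add: max_indeps_def)
      from insert_in_indeps[OF this] 2 show ?thesis
        by (simp add: max_indeps_def)
    qed
  qed
  moreover have "?A \<inter> ?B = {}"
    by (auto simp: max_indeps_def indeps_def)
  moreover have "finite ?A" "finite ?B"
    using fin' by (auto simp: finite_max_indeps)
  moreover have "card (insert r ` max_indeps ?N) = count ?N"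
    unfolding count_def
    by (intro card_image inj_onI) (auto simp: max_indeps_def indeps_def)
  ultimately show ?thesis
    by (auto simp: count_def card_Un_disjoint)
qed

end

section \<open>Attaching two rooted branches to a new root\<close>

text \<open>Integer-valued because it can be negative: a single vertex has weight -1.\<close>

definition weight :: "'a set \<Rightarrow> int" where
  "weight V = 2 * int (card V) - 3 * int (alpha V)"

text \<open>Deleting one vertex lowers \<open>alpha\<close> by at most one, whence the two cases.
  For finite \<open>V\<close>, the exponent in the second case is
  \<open>weight (V - {c})\<close>.\<close>

definition good :: "'a set \<Rightarrow> 'a \<Rightarrow> bool" where
  "good V c \<longleftrightarrow>
    (alpha V = alpha (V - {c}) \<and>
      (\<exists>p q. upper_weights p q \<and> real (count V) = p * golden powi weight V
        \<and> real (count (V - {c})) = q * golden powi weight V)) \<or>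
    (alpha V = alpha (V - {c}) + 1 \<and>
      (\<exists>x y. lower_weights x y \<and> real (count V) = x * golden powi (weight V + 1)
        \<and> real (count (V - {c})) = y * golden powi (weight V + 1)))"

lemma good_upperI:
  assumes "alpha V = alpha (V - {c})" "upper_weights p q"
    "real (count V) = p * golden powi weight V" "real (count (V - {c})) = q * golden powi weight V"
  shows "good V c"
  unfolding good_def using assms by (intro disjI1 conjI exI)

lemma good_lowerI:
  assumes "alpha V = alpha (V - {c}) + 1" "lower_weights x y"
    "real (count V) = x * golden powi (weight V + 1)"
    "real (count (V - {c})) = y * golden powi (weight V + 1)"
  shows "good V c"
  unfolding good_def using assms by (intro disjI2 conjI exI)

lemma good_cases [consumes 1, case_names upper lower]:
  assumes "good V c"
  obtains p q where "alpha V = alpha (V - {c})" "upper_weights p q"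
    "real (count V) = p * golden powi weight V" "real (count (V - {c})) = q * golden powi weight V"
  | x y where "alpha V = alpha (V - {c}) + 1" "lower_weights x y"
    "real (count V) = x * golden powi (weight V + 1)"
    "real (count (V - {c})) = y * golden powi (weight V + 1)"
  using assms unfolding good_def by (elim disjE conjE exE) (rule that; assumption)+

lemma good_empty: "good {} c"
  by (rule good_upperI[where p = 1 and q = 1])
    (auto simp: upper_weights_def count_empty alpha_empty weight_def)

lemma good_imp_count_le:
  assumes "good V c"
  shows "real (count V) \<le> golden powi (weight V + 1)"
  using assms
proof (cases rule: good_cases)
  case (upper p q)
  have "p * golden powi weight V \<le> golden * golden powi weight V"
    using upper_weights_le_golden[OF upper(2)] golden_gt_1
    by (intro mult_right_mono) (auto simp: zero_le_power_int)
  then show ?thesis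
    using golden_gt_1 by (simp add: upper(3) power_int_add_1')
next
  case (lower x y)
  have "x * golden powi (weight V + 1) \<le> 1 * golden powi (weight V + 1)"
    using lower(2) golden_gt_1
    by (intro mult_right_mono) (auto simp: lower_weights_def zero_le_power_int)
  then show ?thesis
    by (simp add: lower(3))
qed

text \<open>Intersecting \<open>{c}\<close> with \<open>V\<close> in the neighbour condition admits
  the empty branch, for which \<open>c\<close> is a dummy.\<close>

context
  fixes V W :: "'a set" and r c d :: 'a
  assumes fin: "finite V" "finite W"
    and disj: "V \<inter> W = {}" "r \<notin> V" "r \<notin> W"
    and nonadj: "\<And>x y. x \<in> V \<Longrightarrow> y \<in> W \<Longrightarrow> (x, y) \<notin> E"
    and nbrs: "E `` {r} \<inter> V = {c} \<inter> V" "E `` {r} \<inter> W = {d} \<inter> W"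
begin

lemma remove_root: "insert r (V \<union> W) - {r} = V \<union> W"
  using disj by auto

lemma remove_root_nbrs:
  "insert r (V \<union> W) - insert r (E `` {r}) = (V - {c}) \<union> (W - {d})"
proof -
  have "X - A = X - B" if "A \<inter> X = B \<inter> X" for X A B :: "'a set"
    using that by blast
  from this[OF nbrs(1)] this[OF nbrs(2)]
  have "V - E `` {r} = V - {c}" "W - E `` {r} = W - {d}" .
  moreover have "insert r (V \<union> W) - insert r (E `` {r}) = (V - E `` {r}) \<union> (W - E `` {r})"
    using disj(2,3) by auto
  ultimately show ?thesis
    by simp
qed

lemma alpha_count_branches:
  "alpha (V \<union> W) = alpha V + alpha W"
  "count (V \<union> W) = count V * count W"
  "alpha ((V - {c}) \<union> (W - {d})) = alpha (V - {c}) + alpha (W - {d})"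
  "count ((V - {c}) \<union> (W - {d})) = count (V - {c}) * count (W - {d})"
proof -
  show "alpha (V \<union> W) = alpha V + alpha W"
    using fin disj(1) nonadj by (rule alpha_Un)
  show "count (V \<union> W) = count V * count W"
    using fin disj(1) nonadj by (rule count_Un)
  have *: "finite (V - {c})" "finite (W - {d})" "(V - {c}) \<inter> (W - {d}) = {}"
    using fin disj(1) by auto
  have **: "(x, y) \<notin> E" if "x \<in> V - {c}" "y \<in> W - {d}" for x y
    using that nonadj by simp
  show "alpha ((V - {c}) \<union> (W - {d})) = alpha (V - {c}) + alpha (W - {d})"
    using * ** by (rule alpha_Un)
  show "count ((V - {c}) \<union> (W - {d})) = count (V - {c}) * count (W - {d})"
    using * ** by (rule count_Un)
qed

lemma alpha_join:
  "alpha (insert r (V \<union> W)) = max (alpha V + alpha W) (alpha (V - {c}) + alpha (W - {d}) + 1)"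
proof -
  have "finite (insert r (V \<union> W))" "r \<in> insert r (V \<union> W)"
    using fin by auto
  from alpha_delete[OF this] show ?thesis
    unfolding remove_root remove_root_nbrs alpha_count_branches .
qed

lemma count_join:
  "count (insert r (V \<union> W)) =
    (if alpha V + alpha W = alpha (insert r (V \<union> W)) then count V * count W else 0)
    + (if alpha (V - {c}) + alpha (W - {d}) + 1 = alpha (insert r (V \<union> W))
       then count (V - {c}) * count (W - {d}) else 0)"
proof -
  have "finite (insert r (V \<union> W))" "r \<in> insert r (V \<union> W)"
    using fin by auto
  from count_delete[OF this] show ?thesis
    unfolding remove_root remove_root_nbrs alpha_count_branches .
qed

lemma card_join: "card (insert r (V \<union> W)) = card V + card W + 1"
  using fin disj by (simp add: card_Un_disjoint)

text \<open>Taking \<open>r\<close> and leaving it out are equally good here, so both products are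
  counted. The new vertex adds 2 to the weight: one factor golden belongs to the second-kind branch
  \<open>V\<close>, the other is the divisor in the new weights.\<close>

lemma good_join_mixed:
  assumes "alpha V = alpha (V - {c}) + 1" "lower_weights x y"
    "real (count V) = x * golden powi (weight V + 1)"
    "real (count (V - {c})) = y * golden powi (weight V + 1)"
    and "alpha W = alpha (W - {d})" "upper_weights p q"
    "real (count W) = p * golden powi weight W" "real (count (W - {d})) = q * golden powi weight W"
  shows "good (insert r (V \<union> W)) r"
proof (rule good_upperI)
  let ?U = "insert r (V \<union> W)"
  have a: "alpha ?U = alpha V + alpha W"
    using assms(1,5) by (simp add: alpha_join)
  have w: "weight ?U = (weight V + 1) + weight W + 1"
    unfolding weight_def card_join a by simp
  have g: "golden powi weight ?U = golden * (golden powi (weight V + 1) * golden powi weight W)"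
    using golden_gt_1 unfolding w by (simp add: power_int_add power2_eq_square)
  show "alpha ?U = alpha (?U - {r})"
    by (simp add: a remove_root alpha_count_branches)
  show "upper_weights ((x * p + y * q) / golden) (x * p / golden)"
    using assms(2,6) by (rule upper_weights_combine)
  have "real (count ?U) = real (count V) * real (count W)
      + real (count (V - {c})) * real (count (W - {d}))"
    using assms(1,5) by (simp add: count_join a)
  then show "real (count ?U) = (x * p + y * q) / golden * golden powi weight ?U"
    unfolding g assms(3,4,7,8) using golden_gt_1 by (simp add: field_simps)
  have "real (count (?U - {r})) = real (count V) * real (count W)"
    by (simp add: remove_root alpha_count_branches)
  then show "real (count (?U - {r})) = x * p / golden * golden powi weight ?U"
    unfolding g assms(3,7) using golden_gt_1 by (simp add: field_simps)
qed

text \<open>Taking \<open>r\<close> wins by one, so every maximum independent set contains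
  \<open>r\<close> and avoids \<open>c\<close> and \<open>d\<close>. Hence the products of
  \<open>q\<close> count the whole and the products of \<open>p\<close> count what remains without
  \<open>r\<close>.\<close>

lemma good_join_upper:
  assumes "alpha V = alpha (V - {c})" "upper_weights p q"
    "real (count V) = p * golden powi weight V" "real (count (V - {c})) = q * golden powi weight V"
    and "alpha W = alpha (W - {d})" "upper_weights p' q'"
    "real (count W) = p' * golden powi weight W" "real (count (W - {d})) = q' * golden powi weight W"
  shows "good (insert r (V \<union> W)) r"
proof (rule good_lowerI)
  let ?U = "insert r (V \<union> W)"
  have a: "alpha ?U = alpha V + alpha W + 1"
    using assms(1,5) by (simp add: alpha_join)
  have w: "weight ?U + 1 = weight V + weight W"
    unfolding weight_def card_join a by simp
  have g: "golden powi (weight ?U + 1) = golden powi weight V * golden powi weight W"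
    using golden_gt_1 unfolding w by (simp add: power_int_add)
  show "alpha ?U = alpha (?U - {r}) + 1"
    by (simp add: a remove_root alpha_count_branches)
  show "lower_weights (q * q') (p * p')"
    using assms(2,6) by (rule lower_weights_mult)
  have "real (count ?U) = real (count (V - {c})) * real (count (W - {d}))"
    using assms(1,5) by (simp add: count_join a)
  then show "real (count ?U) = q * q' * golden powi (weight ?U + 1)"
    unfolding g assms(4,8) by simp
  have "real (count (?U - {r})) = real (count V) * real (count W)"
    by (simp add: remove_root alpha_count_branches)
  then show "real (count (?U - {r})) = p * p' * golden powi (weight ?U + 1)"
    unfolding g assms(3,7) by simp
qed

text \<open>Leaving \<open>r\<close> out wins by one, so deleting it changes no maximum independent
  set and both weights agree. The 2 that \<open>r\<close> adds to the weight supplies the two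
  shifted exponents.\<close>

lemma good_join_lower:
  assumes "alpha V = alpha (V - {c}) + 1" "lower_weights x y"
    "real (count V) = x * golden powi (weight V + 1)"
    and "alpha W = alpha (W - {d}) + 1" "lower_weights x' y'"
    "real (count W) = x' * golden powi (weight W + 1)"
  shows "good (insert r (V \<union> W)) r"
proof (rule good_upperI)
  let ?U = "insert r (V \<union> W)"
  have a: "alpha ?U = alpha V + alpha W"
    using assms(1,4) by (simp add: alpha_join)
  have w: "weight ?U = (weight V + 1) + (weight W + 1)"
    unfolding weight_def card_join a by simp
  have g: "golden powi weight ?U = golden powi (weight V + 1) * golden powi (weight W + 1)"
    using golden_gt_1 unfolding w by (subst power_int_add) auto
  show "alpha ?U = alpha (?U - {r})"
    by (simp add: a remove_root alpha_count_branches)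
  show "upper_weights (x * x') (x * x')"
    using assms(2,5) by (rule upper_weights_diag)
  have "real (count ?U) = real (count V) * real (count W)"
    using assms(1,4) by (simp add: count_join a)
  then show "real (count ?U) = x * x' * golden powi weight ?U"
    unfolding g assms(3,6) by simp
  have "real (count (?U - {r})) = real (count V) * real (count W)"
    by (simp add: remove_root alpha_count_branches)
  then show "real (count (?U - {r})) = x * x' * golden powi weight ?U"
    unfolding g assms(3,6) by simp
qed

end

lemma good_join:
  assumes "finite V" "finite W" "V \<inter> W = {}" "r \<notin> V" "r \<notin> W"
    and nonadj: "\<And>x y. x \<in> V \<Longrightarrow> y \<in> W \<Longrightarrow> (x, y) \<notin> E"
    and "E `` {r} \<inter> V = {c} \<inter> V" "E `` {r} \<inter> W = {d} \<inter> W"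
    and "good V c" "good W d"
  shows "good (insert r (V \<union> W)) r"
proof -
  have nonadj': "\<And>x y. x \<in> W \<Longrightarrow> y \<in> V \<Longrightarrow> (x, y) \<notin> E"
    using nonadj adj_commute by blast
  have disj': "W \<inter> V = {}"
    using assms(3) by blast
  note VW = assms(1-5) nonadj assms(7,8)
  \<comment> \<open>The mixed case has its second-kind branch first; the opposite order follows by
    exchanging the branches.\<close>
  note WV = assms(2,1) disj' assms(5,4) nonadj' assms(8,7)
  from assms(9) show ?thesis
  proof (cases rule: good_cases)
    case V: (upper p q)
    from assms(10) show ?thesis
    proof (cases rule: good_cases)
      case W: (upper p' q')
      show ?thesis
        by (rule good_join_upper[OF VW V W])
    next
      case W: (lower x y)
      show ?thesis
        using good_join_mixed[OF WV W V] by (simp add: Un_commute)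
    qed
  next
    case V: (lower x y)
    from assms(10) show ?thesis
    proof (cases rule: good_cases)
      case W: (upper p q)
      show ?thesis
        by (rule good_join_mixed[OF VW V W])
    next
      case W: (lower x' y')
      show ?thesis
        by (rule good_join_lower[OF VW V(1-3) W(1-3)])
    qed
  qed
qed

end

section \<open>Branches of a rooted tree\<close>

text \<open>
  Acyclicity is only needed in the form that two neighbours of a vertex \<open>r\<close> lie in different
  components once \<open>r\<close> is removed. Unlike the absence of cycles, this needs no walks.
\<close>

locale tree_adjacency = adjacency E for E :: "'a rel" +
  assumes separated:
    "(r, c) \<in> E \<Longrightarrow> (r, d) \<in> E \<Longrightarrow> c \<noteq> d \<Longrightarrow> (c, d) \<notin> (Restr E (- {r}))\<^sup>*"
begin

definition rooted :: "'a set \<Rightarrow> 'a \<Rightarrow> bool" where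
  "rooted V r \<longleftrightarrow> r \<in> V \<and> (\<forall>x\<in>V. (r, x) \<in> (Restr E V)\<^sup>*)"

text \<open>The component of \<open>c\<close> in \<open>V - {r}\<close>. As reachability is
  reflexive, the two conditions on \<open>c\<close> are what makes the branch of a non-child
  empty.\<close>

definition branch :: "'a set \<Rightarrow> 'a \<Rightarrow> 'a \<Rightarrow> 'a set" where
  "branch V r c = {x. (r, c) \<in> E \<and> c \<in> V \<and> (c, x) \<in> (Restr E (V - {r}))\<^sup>*}"

lemma branch_subset: "branch V r c \<subseteq> V - {r}"
proof
  fix x assume "x \<in> branch V r c"
  then have "(r, c) \<in> E" "c \<in> V" "(c, x) \<in> (Restr E (V - {r}))\<^sup>*"
    by (auto simp: branch_def)
  from this(3) show "x \<in> V - {r}"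
  proof (cases rule: rtrancl.cases)
    case rtrancl_refl
    then show ?thesis
      using \<open>(r, c) \<in> E\<close> \<open>c \<in> V\<close> not_adj_self by auto
  qed auto
qed

lemma root_in_branch: "(r, c) \<in> E \<Longrightarrow> c \<in> V \<Longrightarrow> c \<in> branch V r c"
  by (simp add: branch_def)

lemma branch_step:
  assumes "x \<in> branch V r c" and "(x, y) \<in> E" and "y \<in> V - {r}"
  shows "y \<in> branch V r c"
proof -
  have "(x, y) \<in> Restr E (V - {r})"
    using assms branch_subset[of V r c] by auto
  with assms(1) show ?thesis
    unfolding branch_def by (auto intro: rtrancl_into_rtrancl)
qed

text \<open>A common vertex would connect \<open>c\<close> to \<open>d\<close> while avoiding
  \<open>r\<close>, against \<open>separated\<close>.\<close>

lemma branch_disjoint: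
  assumes "c \<noteq> d"
  shows "branch V r c \<inter> branch V r d = {}"
proof (rule ccontr)
  assume "branch V r c \<inter> branch V r d \<noteq> {}"
  then obtain x where x: "(r, c) \<in> E" "(c, x) \<in> (Restr E (V - {r}))\<^sup>*"
    "(r, d) \<in> E" "(d, x) \<in> (Restr E (V - {r}))\<^sup>*"
    by (auto simp: branch_def)
  have "sym ((Restr E (V - {r}))\<^sup>*)"
    using sym_E by (intro sym_rtrancl) (auto simp: sym_def)
  with x(4) have "(x, d) \<in> (Restr E (V - {r}))\<^sup>*"
    by (rule symD[rotated])
  with x(2) have "(c, d) \<in> (Restr E (V - {r}))\<^sup>*"
    by (rule rtrancl_trans)
  moreover have "Restr E (V - {r}) \<subseteq> Restr E (- {r})"
    by auto
  ultimately have "(c, d) \<in> (Restr E (- {r}))\<^sup>*"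
    using rtrancl_mono by blast
  with separated x(1,3) assms show False
    by blast
qed

lemma branch_nonadj:
  assumes "c \<noteq> d" "x \<in> branch V r c" "y \<in> branch V r d"
  shows "(x, y) \<notin> E"
proof
  assume "(x, y) \<in> E"
  then have "y \<in> branch V r c"
    by (rule branch_step[OF assms(2)]) (use assms(3) branch_subset in auto)
  then show False
    using branch_disjoint[OF assms(1)] assms(3) by blast
qed

text \<open>A second neighbour \<open>x\<close> of \<open>r\<close> in the branch would also lie in
  its own branch, which is disjoint from this one.\<close>

lemma branch_nbrs: "E `` {r} \<inter> branch V r c = {c} \<inter> branch V r c"
proof -
  have "x = c" if "(r, x) \<in> E" "x \<in> branch V r c" for x
  proof (rule ccontr)
    assume "x \<noteq> c"
    have "x \<in> branch V r x"
      using that branch_subset[of V r c] by (intro root_in_branch) auto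
    with branch_disjoint[OF \<open>x \<noteq> c\<close>] that show False
      by blast
  qed
  moreover have "(r, c) \<in> E" if "c \<in> branch V r c"
    using that by (simp add: branch_def)
  ultimately show ?thesis
    by auto
qed

lemma rooted_branch:
  assumes "(r, c) \<in> E" "c \<in> V"
  shows "rooted (branch V r c) c"
  unfolding rooted_def
proof (intro conjI ballI)
  show "c \<in> branch V r c"
    using assms by (rule root_in_branch)
  fix x assume "x \<in> branch V r c"
  then have "(c, x) \<in> (Restr E (V - {r}))\<^sup>*"
    by (simp add: branch_def)
  then show "(c, x) \<in> (Restr E (branch V r c))\<^sup>*"
  proof (induction rule: rtrancl_induct)
    case (step y z)
    have "y \<in> branch V r c"
      using step(1) assms by (simp add: branch_def)
    moreover from this have "z \<in> branch V r c"
      by (rule branch_step) (use step(2) in auto)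
    ultimately have "(y, z) \<in> Restr E (branch V r c)"
      using step(2) by auto
    with step.IH show ?case
      by (rule rtrancl_into_rtrancl)
  qed simp
qed

text \<open>Along a walk from \<open>r\<close>, each step enters a branch at its root, stays in its
  branch, or returns to \<open>r\<close>.\<close>

lemma rooted_eq_branches:
  assumes "rooted V r"
  shows "V = insert r (\<Union>c \<in> E `` {r} \<inter> V. branch V r c)"
proof (intro equalityI subsetI)
  fix x assume "x \<in> V"
  then have "(r, x) \<in> (Restr E V)\<^sup>*"
    using assms by (simp add: rooted_def)
  then show "x \<in> insert r (\<Union>c \<in> E `` {r} \<inter> V. branch V r c)"
  proof (induction rule: rtrancl_induct)
    case (step y z)
    show ?case
    proof (cases "z = r")
      case False
      from step.IH show ?thesis
      proof
        assume "y = r"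
        then show ?thesis
          using step(2) root_in_branch by auto
      next
        assume "y \<in> (\<Union>c \<in> E `` {r} \<inter> V. branch V r c)"
        then show ?thesis
          using step(2) False branch_step[of y V r _ z] by auto
      qed
    qed simp
  qed simp
next
  fix x assume "x \<in> insert r (\<Union>c \<in> E `` {r} \<inter> V. branch V r c)"
  then show "x \<in> V"
    using branch_subset assms by (auto simp: rooted_def)
qed

lemma branch_psubset:
  assumes "r \<in> V"
  shows "branch V r c \<subset> V"
  using branch_subset[of V r c] assms by blast

text \<open>The bound 2 is inherited: a child has at most three neighbours, and one of them is
  \<open>r\<close>, which lies outside the child's branch.\<close>

lemma good_rooted:
  assumes "finite V" and "rooted V r" and "card (E `` {r} \<inter> V) \<le> 2"
    and "\<And>v. v \<in> V \<Longrightarrow> finite (E `` {v}) \<and> card (E `` {v}) \<le> 3"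
  shows "good V r"
  using assms
proof (induction V arbitrary: r rule: finite_psubset_induct)
  case (psubset V)
  have r: "r \<in> V"
    using psubset.prems(1) by (simp add: rooted_def)
  let ?N = "E `` {r} \<inter> V"
  \<comment> \<open>Missing children are replaced by \<open>r\<close>, whose branch is empty since
    \<open>r\<close> is not its own neighbour. The names coincide only if there is no child at
    all.\<close>
  obtain c d where cd: "?N \<subseteq> {c, d}" "c \<noteq> d \<or> ?N = {}"
  proof -
    have fin: "finite ?N"
      using psubset.hyps by auto
    from psubset.prems(2) consider "card ?N = 0" | "card ?N = 1" | "card ?N = 2"
      by linarith
    then show ?thesis
    proof cases
      case 1
      then show ?thesis
        using that[of r r] fin by simp
    next
      case 2
      then obtain c where "?N = {c}"
        by (auto simp: card_1_singleton_iff)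
      moreover from this have "c \<noteq> r"
        using not_adj_self by auto
      ultimately show ?thesis
        using that[of c r] by auto
    next
      case 3
      then show ?thesis
        using that by (auto simp: card_2_iff)
    qed
  qed
  have empty: "branch V r e = {}" if "e \<notin> ?N" for e
    using that by (auto simp: branch_def)
  have good: "good (branch V r e) e" for e
  proof (cases "e \<in> ?N")
    case True
    show ?thesis
    proof (rule psubset.IH)
      show "branch V r e \<subset> V"
        using r by (rule branch_psubset)
      show "rooted (branch V r e) e"
        using True by (intro rooted_branch) auto
      have e: "finite (E `` {e})" "card (E `` {e}) \<le> 3"
        using psubset.prems(3) True by auto
      have "r \<in> E `` {e}"
        using True adj_commute by auto
      then have "card (E `` {e} - {r}) \<le> 2"
        using e by simp
      moreover have "E `` {e} \<inter> branch V r e \<subseteq> E `` {e} - {r}"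
        using branch_subset[of V r e] by auto
      ultimately show "card (E `` {e} \<inter> branch V r e) \<le> 2"
        using e(1) by (meson card_mono finite_Diff le_trans)
      show "finite (E `` {v}) \<and> card (E `` {v}) \<le> 3" if "v \<in> branch V r e" for v
        using psubset.prems(3) that branch_subset[of V r e] by auto
    qed
  qed (simp add: empty good_empty)
  have "(\<Union>e \<in> ?N. branch V r e) = branch V r c \<union> branch V r d"
    using cd(1) empty by blast
  then have V: "V = insert r (branch V r c \<union> branch V r d)"
    using rooted_eq_branches[OF psubset.prems(1)] by simp
  have fin: "finite (branch V r e)" for e
    using branch_subset psubset.hyps by (metis finite_Diff finite_subset)
  have disj: "branch V r c \<inter> branch V r d = {}"
    using cd(2) branch_disjoint empty by blast
  have nonadj: "(x, y) \<notin> E" if "x \<in> branch V r c" "y \<in> branch V r d" for x y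
    using cd(2) branch_nonadj that empty by blast
  have notin: "r \<notin> branch V r e" for e
    using branch_subset by blast
  have "good (insert r (branch V r c \<union> branch V r d)) r"
    by (rule good_join[OF fin fin disj notin notin nonadj branch_nbrs branch_nbrs good good])
  then show ?case
    using V by simp
qed

text \<open>The last conjunct carries the induction. A leaf of a branch other than its root
  \<open>c\<close> is not adjacent to \<open>r\<close> and stays a leaf; if it is \<open>c\<close>,
  the branch is \<open>{c}\<close> and \<open>r\<close> is its only possible neighbour.\<close>

lemma leaf_exists:
  assumes "finite V" and "rooted V r"
  shows "\<exists>x\<in>V. card (E `` {x} \<inter> V) \<le> 1 \<and> (x = r \<longrightarrow> V = {r})"
  using assms
proof (induction V arbitrary: r rule: finite_psubset_induct)
  case (psubset V)
  have r: "r \<in> V"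
    using psubset.prems by (simp add: rooted_def)
  show ?case
  proof (cases "E `` {r} \<inter> V = {}")
    case True
    then have "V = {r}"
      using rooted_eq_branches[OF psubset.prems] by auto
    then show ?thesis
      using not_adj_self by auto
  next
    case False
    then obtain c where c: "(r, c) \<in> E" "c \<in> V"
      by auto
    let ?K = "branch V r c"
    obtain x where x: "x \<in> ?K" "card (E `` {x} \<inter> ?K) \<le> 1" "x = c \<longrightarrow> ?K = {c}"
      using psubset.IH[OF branch_psubset[OF r] rooted_branch[OF c]] by blast
    have sub: "E `` {x} \<inter> V \<subseteq> insert r (E `` {x} \<inter> ?K)"
      using branch_step[OF x(1)] by auto
    have "card (E `` {x} \<inter> V) \<le> 1"
    proof (cases "x = c")
      case True
      with x sub have "E `` {x} \<inter> V \<subseteq> {r}"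
        using not_adj_self by auto
      then show ?thesis
        using card_mono[of "{r}"] by fastforce
    next
      case False
      have "(r, x) \<notin> E"
        using branch_nbrs[of r V c] x(1) False by auto
      then have "E `` {x} \<inter> V = E `` {x} \<inter> ?K"
        using sub branch_subset[of V r c] adj_commute by auto
      with x(2) show ?thesis
        by simp
    qed
    moreover have "x \<in> V" "x \<noteq> r"
      using x(1) branch_subset[of V r c] by auto
    ultimately show ?thesis
      by blast
  qed
qed

end

section \<open>Trees as adjacency relations\<close>

text \<open>A walk from \<open>c\<close> to \<open>d\<close> that avoids \<open>r\<close> shortens
  to a path, which the two edges at \<open>r\<close> close to a cycle.\<close>

lemma undirected_tree_separated:
  assumes T: "undirected_tree T"
    and rc: "(r, c) \<in> parcs T" and rd: "(r, d) \<in> parcs T" and "c \<noteq> d"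
  shows "(c, d) \<notin> (Restr (parcs T) (- {r}))\<^sup>*"
proof
  interpret pair_graph T
    using T by (simp add: undirected_tree_def)
  assume "(c, d) \<in> (Restr (parcs T) (- {r}))\<^sup>*"
  then have "\<exists>p. awalk c p d \<and> set p \<subseteq> Restr (parcs T) (- {r})"
  proof (induction rule: rtrancl_induct)
    case base
    show ?case
      using rc by (intro exI[of _ "[]"]) (auto simp: awalk_Nil_iff in_arcsD2)
  next
    case (step y z)
    then obtain p where p: "awalk c p y" "set p \<subseteq> Restr (parcs T) (- {r})"
      by blast
    have "awalk y [(y, z)] z"
      using step(2) by (auto simp: awalk_simps in_arcsD2)
    with p have "awalk c (p @ [(y, z)]) z"
      by (blast intro: awalk_appendI)
    then show ?case
      using p(2) step(2) by (intro exI[of _ "p @ [(y, z)]"]) auto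
  qed
  then obtain p where p: "awalk c p d" "set p \<subseteq> Restr (parcs T) (- {r})"
    by blast
  define q where "q = awalk_to_apath p"
  have q: "apath c q d" "set q \<subseteq> Restr (parcs T) (- {r})"
    using apath_awalk_to_apath[OF p(1)] awalk_to_apath_subset[OF p(1)] p(2) by (auto simp: q_def)
  then have aq: "awalk c q d" "distinct (awalk_verts c q)"
    by (auto simp: apath_def)
  have "q \<noteq> []"
    using aq(1) \<open>c \<noteq> d\<close> by (auto simp: awalk_Nil_iff)
  \<comment> \<open>A nonempty walk visits only endpoints of its arcs, and no arc of
    \<open>q\<close> touches \<open>r\<close>.\<close>
  have "r \<notin> set (awalk_verts c q)"
    using set_awalk_verts_not_Nil[OF aq(1) \<open>q \<noteq> []\<close>] q(2) by auto
  have dr: "(d, r) \<in> parcs T"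
    using rd arcs_symmetric by blast
  have "awalk d [(d, r)] r"
    using dr by (auto simp: awalk_simps in_arcsD2)
  with aq(1) have w: "awalk c (q @ [(d, r)]) r"
    by (rule awalk_appendI)
  then have "awalk r ((r, c) # q @ [(d, r)]) r"
    using rc by (simp add: awalk_Cons_iff del: awalk_append_iff)
  moreover have "distinct (tl (awalk_verts r ((r, c) # q @ [(d, r)])))"
    using awalk_verts_append[OF w] aq \<open>r \<notin> set (awalk_verts c q)\<close> by simp
  ultimately have "cycle ((r, c) # q @ [(d, r)])"
    unfolding cycle_def by blast
  \<comment> \<open>Here \<open>c \<noteq> d\<close> matters: it makes \<open>q\<close> nonempty,
    which excludes going along one edge and back.\<close>
  moreover have "3 \<le> length ((r, c) # q @ [(d, r)])"
    using \<open>q \<noteq> []\<close> by (cases q) auto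
  ultimately show False
    using T by (auto simp: undirected_tree_def undirected_cycle_def)
qed

text \<open>Connectedness of a digraph ignores directions; symmetry of the arcs turns it into
  directed reachability.\<close>

lemma undirected_tree_reachable:
  assumes T: "undirected_tree T" and "x \<in> pverts T" "y \<in> pverts T"
  shows "(x, y) \<in> (Restr (parcs T) (pverts T))\<^sup>*"
proof -
  interpret pair_graph T
    using T by (simp add: undirected_tree_def)
  have "symmetric (with_proj T)"
    using arcs_symmetric by (auto simp: symmetric_def intro: symI)
  then have "strongly_connected (with_proj T)"
    using symmetric_connected_imp_strongly_connected T
    by (simp add: undirected_tree_def)
  then have "x \<rightarrow>\<^sup>*\<^bsub>with_proj T\<^esub> y"
    using assms(2,3) by auto
  then have "(x, y) \<in> (parcs T)\<^sup>*"
    using reachable_rtranclI by fastforce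
  moreover have "Restr (parcs T) (pverts T) = parcs T"
    by (auto simp: in_arcsD1 in_arcsD2)
  ultimately show ?thesis
    by simp
qed

lemma tree_adjacency_parcs:
  assumes "undirected_tree T"
  shows "tree_adjacency (parcs T)"
proof -
  interpret pair_graph T
    using assms by (simp add: undirected_tree_def)
  show ?thesis
  proof
    show "sym (parcs T)"
      using arcs_symmetric by (auto intro: symI)
    show "irrefl (parcs T)"
      using no_loops' by (auto intro: irreflI)
    show "(c, d) \<notin> (Restr (parcs T) (- {r}))\<^sup>*"
      if "(r, c) \<in> parcs T" "(r, d) \<in> parcs T" "c \<noteq> d" for r c d
      using assms that by (rule undirected_tree_separated)
  qed
qed

lemma subcubic_nbrs:
  assumes "pair_graph T" and "subcubic T" and "v \<in> pverts T"
  shows "finite (parcs T `` {v})" "card (parcs T `` {v}) \<le> 3"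
proof -
  interpret pair_graph T
    by fact
  have fin: "finite (out_arcs T v)"
    by (rule finite_subset[of _ "parcs T"]) auto
  have img: "parcs T `` {v} = snd ` out_arcs T v"
    by (force simp: out_arcs_def)
  show "finite (parcs T `` {v})"
    using fin by (simp add: img)
  have "card (parcs T `` {v}) \<le> out_degree T v"
    unfolding img out_degree_def by (rule card_image_le[OF fin])
  also have "\<dots> \<le> 3"
    using assms(2,3) by (simp add: subcubic_def)
  finally show "card (parcs T `` {v}) \<le> 3" .
qed

theorem theorem6:
  fixes T :: "'a pair_pre_digraph" and n \<alpha> :: nat
  assumes "undirected_tree T"
    and "subcubic T"
    and "card (pverts T) = n"
    and "independence_number T = \<alpha>"
  shows "real (num_maximum_independent_sets T)
           \<le> ((1 + sqrt 5) / 2) powi (2 * int n - 3 * int \<alpha> + 1)"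
proof -
  interpret pair_graph T
    using assms(1) by (simp add: undirected_tree_def)
  interpret T: tree_adjacency "parcs T"
    using assms(1) by (rule tree_adjacency_parcs)
  have rooted: "T.rooted (pverts T) x" if "x \<in> pverts T" for x
    using that undirected_tree_reachable[OF assms(1)] by (simp add: T.rooted_def)
  obtain v where "v \<in> pverts T"
    using assms(1)
    by (auto simp: undirected_tree_def connected_def strongly_connected_def)
  \<comment> \<open>A root with at most one neighbour meets the bound 2 that
    \<open>good_rooted\<close> asks of its root.\<close>
  then obtain r where r: "r \<in> pverts T" "card (parcs T `` {r} \<inter> pverts T) \<le> 1"
    using T.leaf_exists[OF pair_finite_verts rooted[OF \<open>v \<in> pverts T\<close>]] by auto
  have "T.good (pverts T) r"
  proof (rule T.good_rooted)
    show "finite (parcs T `` {v}) \<and> card (parcs T `` {v}) \<le> 3" if "v \<in> pverts T" for v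
      using subcubic_nbrs[OF pair_graph assms(2) that] by simp
  qed (use r rooted pair_finite_verts in auto)
  then have le: "real (T.count (pverts T)) \<le> golden powi (T.weight (pverts T) + 1)"
    by (rule T.good_imp_count_le)
  have "{S. independent_set T S} = T.indeps (pverts T)"
    by (auto simp: independent_set_def T.indeps_def)
  then have a: "independence_number T = T.alpha (pverts T)"
    by (simp add: independence_number_def T.alpha_def)
  have "{S. maximum_independent_set T S} = T.max_indeps (pverts T)"
    unfolding maximum_independent_set_def T.max_indeps_def a
    by (auto simp: independent_set_def T.indeps_def)
  then have "num_maximum_independent_sets T = T.count (pverts T)"
    by (simp add: num_maximum_independent_sets_def T.count_def)
  with le show ?thesis
    using a assms(3,4) by (simp add: T.weight_def golden_def)
qed

end
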